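(* Let $d\ge 3$ be an integer and let $p_{d+3,d}$ denote the number of $d$-minimal permutations of length $d+3$. Then $$p_{d+3,d}=3^{d+3}-(d^2+4d+7)\cdot 2^{d+2}+\frac12 d^4+\frac52 d^3+5d^2+6d+1.$$
   Context: A descent of a permutation $\sigma=\sigma(1)\cdots\sigma(n)$ of $\{1,\dots,n\}$ is an index $i\in\{1,\dots,n-1\}$ with $\sigma(i)>\sigma(i+1)$. A permutation $\sigma$ of length $n$ is $d$-minimal (a minimal permutation with $d$ descents) if it is minimal, for the pattern-involvement order, for the property of having $d$ descents; in other words, $\sigma$ has exactly $d$ descents and, whenever any one of its entries is removed and the remaining entries are renamed order-isomorphically to $1,\dots,n-1$, the resulting permutation has $d-1$ descents. *)

theory Defs
  imports Complex_Main "HOL-Library.Sublist" "HOL-Combinatorics.Multiset_Permutations"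
begin

text \<open>A permutation of \<open>{1..n}\<close> is represented by its word \<open>\<sigma>(1) \<dots> \<sigma>(n)\<close>; list positions
  are counted from 0, so \<open>\<sigma>(i)\<close> is \<open>\<sigma> ! (i - 1)\<close>.\<close>

definition is_perm :: "nat list \<Rightarrow> bool" where
  "is_perm \<sigma> \<longleftrightarrow> \<sigma> \<in> permutations_of_set {1..length \<sigma>}"

definition des :: "nat list \<Rightarrow> nat" where
  "des xs = card {i. Suc i < length xs \<and> xs ! i > xs ! Suc i}"

definition order_iso :: "nat list \<Rightarrow> nat list \<Rightarrow> bool" where
  "order_iso xs ys \<longleftrightarrow> length xs = length ys \<and>
     (\<forall>i<length xs. \<forall>j<length xs. xs ! i < xs ! j \<longleftrightarrow> ys ! i < ys ! j)"

definition involved_in :: "nat list \<Rightarrow> nat list \<Rightarrow> bool" where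
  "involved_in \<tau> \<sigma> \<longleftrightarrow> (\<exists>ys. subseq ys \<sigma> \<and> order_iso \<tau> ys)"

definition d_minimal :: "nat \<Rightarrow> nat list \<Rightarrow> bool" where
  "d_minimal d \<sigma> \<longleftrightarrow> is_perm \<sigma> \<and> des \<sigma> = d \<and>
     (\<forall>\<tau>. is_perm \<tau> \<and> involved_in \<tau> \<sigma> \<and> des \<tau> = d \<longrightarrow> \<tau> = \<sigma>)"

definition num_minimal :: "nat \<Rightarrow> nat \<Rightarrow> nat" where
  "num_minimal n d = card {\<sigma>. d_minimal d \<sigma> \<and> length \<sigma> = n}"

text \<open>The remaining facts show that \<open>d_minimal\<close> agrees with the description by removal of a
  single entry (\<open>d_minimal_iff\<close>) and that \<open>num_minimal\<close> counts a finite set. The function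
  \<open>reduce\<close> renames the distinct entries of a word order-isomorphically to \<open>1, \<dots>, n\<close>.\<close>

definition reduce :: "nat list \<Rightarrow> nat list" where
  "reduce xs = map (\<lambda>x. card {y \<in> set xs. y \<le> x}) xs"

definition remove_nth :: "nat \<Rightarrow> 'a list \<Rightarrow> 'a list" where
  "remove_nth i xs = take i xs @ drop (Suc i) xs"

lemma is_perm_iff: "is_perm \<sigma> \<longleftrightarrow> distinct \<sigma> \<and> set \<sigma> = {1..length \<sigma>}"
  by (auto simp: is_perm_def permutations_of_set_def)

lemma finite_d_minimal: "finite {\<sigma>. d_minimal d \<sigma> \<and> length \<sigma> = n}"
  by (rule finite_subset[of _ "permutations_of_set {1..n}"]) (auto simp: d_minimal_def is_perm_def)

lemma des_simps [simp]:
  "des [] = 0" "des [x] = 0"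
  "des (x # y # zs) = (if x > y then 1 else 0) + des (y # zs)"
proof -
  let ?D = "{i. Suc i < length (y # zs) \<and> (y # zs) ! i > (y # zs) ! Suc i}"
  have "{i. Suc i < length (x # y # zs) \<and> (x # y # zs) ! i > (x # y # zs) ! Suc i}
      = (if x > y then {0} else {}) \<union> Suc ` ?D" (is "?L = ?R")
  proof (rule set_eqI)
    fix i show "i \<in> ?L \<longleftrightarrow> i \<in> ?R" by (cases i) auto
  qed
  moreover have "finite ?D" by (rule finite_subset[of _ "{..<length (y # zs)}"]) auto
  ultimately show "des (x # y # zs) = (if x > y then 1 else 0) + des (y # zs)"
    by (simp add: des_def card_image)
qed (simp_all add: des_def)

lemma des_order_iso:
  assumes "order_iso xs ys" shows "des xs = des ys"
proof -
  have "{i. Suc i < length xs \<and> xs ! i > xs ! Suc i} = {i. Suc i < length ys \<and> ys ! i > ys ! Suc i}"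
    using assms by (auto simp: order_iso_def)
  then show ?thesis by (simp add: des_def)
qed

lemma des_delete: "des (as @ bs) \<le> des (as @ x # bs) \<and> des (as @ x # bs) \<le> Suc (des (as @ bs))"
proof (induction as rule: induct_list012)
  case 1 show ?case by (cases bs) auto
next
  case (2 a) show ?case by (cases bs) auto
qed auto

lemma des_remove_nth:
  assumes "i < length xs"
  shows "des (remove_nth i xs) \<le> des xs" "des xs \<le> Suc (des (remove_nth i xs))"
  using des_delete[of "take i xs" "drop (Suc i) xs" "xs ! i"] assms
  by (simp_all add: remove_nth_def id_take_nth_drop[symmetric])

lemma subseq_remove_nth:
  assumes "subseq ys xs" "ys \<noteq> xs"
  shows "\<exists>i<length xs. subseq ys (remove_nth i xs)"
  using assms
proof (induction rule: list_emb.induct)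
  case (list_emb_Nil ys) then show ?case by (intro exI[of _ 0]) auto
next
  case (list_emb_Cons xs ys y)
  then show ?case by (intro exI[of _ 0]) (auto simp: remove_nth_def)
next
  case (list_emb_Cons2 x y xs ys)
  then obtain i where "i < length ys" "subseq xs (remove_nth i ys)" by auto
  with list_emb_Cons2 show ?case by (intro exI[of _ "Suc i"]) (auto simp: remove_nth_def)
qed

lemma subseq_remove_nth': "subseq (remove_nth i xs) xs"
proof -
  have "subseq (drop (Suc i) xs) (drop i xs)"
  proof (cases "i < length xs")
    case True
    have "subseq (drop (Suc i) xs) (xs ! i # drop (Suc i) xs)"
      by (rule list_emb_Cons) simp
    with True show ?thesis by (simp add: Cons_nth_drop_Suc)
  qed simp
  then have "subseq (take i xs @ drop (Suc i) xs) (take i xs @ drop i xs)"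
    by (intro list_emb_append_mono) simp_all
  then show ?thesis by (simp add: remove_nth_def)
qed

lemma des_subseq:
  "subseq ys xs \<Longrightarrow> des ys \<le> des xs"
proof (induction "length xs" arbitrary: xs)
  case (Suc n)
  show ?case
  proof (cases "ys = xs")
    case False
    then obtain i where i: "i < length xs" "subseq ys (remove_nth i xs)"
      using subseq_remove_nth Suc.prems by blast
    then have "length (remove_nth i xs) = n" using Suc.hyps(2) by (auto simp: remove_nth_def)
    then show ?thesis using Suc.hyps(1)[of "remove_nth i xs"] i des_remove_nth(1)[OF i(1)] by auto
  qed simp
qed (auto dest: list_emb_length)

lemma rank_less_iff:
  assumes "finite A" "x \<in> A" "x' \<in> A"
  shows "card {y \<in> A. y \<le> x} < card {y \<in> A. y \<le> x'} \<longleftrightarrow> x < (x' :: nat)"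
proof
  assume "x < x'"
  then have "{y \<in> A. y \<le> x} \<subset> {y \<in> A. y \<le> x'}" using assms by force
  then show "card {y \<in> A. y \<le> x} < card {y \<in> A. y \<le> x'}" using assms by (simp add: psubset_card_mono)
next
  assume l: "card {y \<in> A. y \<le> x} < card {y \<in> A. y \<le> x'}"
  show "x < x'"
  proof (rule ccontr)
    assume "\<not> x < x'"
    then have "card {y \<in> A. y \<le> x'} \<le> card {y \<in> A. y \<le> x}" using assms by (intro card_mono) auto
    with l show False by simp
  qed
qed

lemma length_reduce [simp]: "length (reduce xs) = length xs"
  by (simp add: reduce_def)

lemma order_iso_reduce: "order_iso (reduce xs) xs"
  by (auto simp: order_iso_def reduce_def rank_less_iff)

lemma is_perm_reduce:
  assumes "distinct xs" shows "is_perm (reduce xs)"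
proof -
  have inj: "inj_on (\<lambda>x. card {y \<in> set xs. y \<le> x}) (set xs)"
  proof (rule inj_onI)
    fix x x' assume x: "x \<in> set xs" "x' \<in> set xs"
      and eq: "card {y \<in> set xs. y \<le> x} = card {y \<in> set xs. y \<le> x'}"
    have "\<not> x < x'" "\<not> x' < x"
      using rank_less_iff[OF finite_set x] rank_less_iff[OF finite_set x(2,1)] eq by linarith+
    then show "x = x'" by simp
  qed
  have "card {y \<in> set xs. y \<le> x} \<in> {1..length xs}" if "x \<in> set xs" for x
  proof -
    have "card {y \<in> set xs. y \<le> x} \<le> card (set xs)" by (intro card_mono) auto
    moreover have "card {y \<in> set xs. y \<le> x} > 0" using that by (auto simp: card_gt_0_iff)
    ultimately show ?thesis using assms by (simp add: distinct_card)
  qed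
  then have "set (reduce xs) \<subseteq> {1..length xs}" by (auto simp: reduce_def)
  moreover have d: "distinct (reduce xs)" using inj assms by (simp add: reduce_def distinct_map)
  ultimately have "set (reduce xs) = {1..length xs}"
    by (intro card_subset_eq) (simp_all add: distinct_card)
  with d show ?thesis by (simp add: is_perm_iff)
qed

lemma order_iso_perm_eq:
  assumes "order_iso \<tau> \<sigma>" "is_perm \<tau>" "is_perm \<sigma>"
  shows "\<tau> = \<sigma>"
proof -
  have rank: "xs ! i = card {j. j < length xs \<and> xs ! j < xs ! i} + 1"
    if "is_perm xs" "i < length xs" for xs :: "nat list" and i
  proof -
    have xs: "distinct xs" "set xs = {1..length xs}" using that by (auto simp: is_perm_iff)
    have mem: "xs ! i \<in> {1..length xs}" using that xs by (metis nth_mem)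
    have "(\<lambda>j. xs ! j) ` {j. j < length xs \<and> xs ! j < xs ! i} = {y \<in> set xs. y < xs ! i}"
      by (auto simp: in_set_conv_nth)
    also have "\<dots> = {1..<xs ! i}" using xs(2) mem by auto
    finally have im: "(\<lambda>j. xs ! j) ` {j. j < length xs \<and> xs ! j < xs ! i} = {1..<xs ! i}" .
    have "inj_on (\<lambda>j. xs ! j) {j. j < length xs \<and> xs ! j < xs ! i}"
      using xs(1) by (auto simp: inj_on_def nth_eq_iff_index_eq)
    from card_image[OF this] have "card {j. j < length xs \<and> xs ! j < xs ! i} = xs ! i - 1"
      by (simp only: im card_atLeastLessThan)
    then show ?thesis using mem by auto
  qed
  have len: "length \<tau> = length \<sigma>" using assms(1) by (simp add: order_iso_def)
  show ?thesis
  proof (rule nth_equalityI[OF len])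
    fix i assume i: "i < length \<tau>"
    have "{j. j < length \<tau> \<and> \<tau> ! j < \<tau> ! i} = {j. j < length \<sigma> \<and> \<sigma> ! j < \<sigma> ! i}"
      using assms(1) i by (auto simp: order_iso_def)
    then show "\<tau> ! i = \<sigma> ! i" using rank[OF assms(2) i] rank[OF assms(3)] i len by simp
  qed
qed

theorem d_minimal_iff:
  "d_minimal d \<sigma> \<longleftrightarrow> is_perm \<sigma> \<and> des \<sigma> = d \<and>
     (\<forall>i<length \<sigma>. Suc (des (reduce (remove_nth i \<sigma>))) = d)"
proof (intro iffI conjI allI impI)
  fix i assume m: "d_minimal d \<sigma>" and i: "i < length \<sigma>"
  let ?\<tau> = "reduce (remove_nth i \<sigma>)"
  have "distinct (remove_nth i \<sigma>)"
    using m set_take_disj_set_drop_if_distinct[of \<sigma> i "Suc i"]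
    by (simp add: d_minimal_def is_perm_iff remove_nth_def)
  then have "is_perm ?\<tau>" by (rule is_perm_reduce)
  moreover have "involved_in ?\<tau> \<sigma>"
    unfolding involved_in_def using subseq_remove_nth' order_iso_reduce by blast
  moreover have "length ?\<tau> \<noteq> length \<sigma>" using i by (simp add: remove_nth_def)
  ultimately have "des ?\<tau> \<noteq> d" using m unfolding d_minimal_def by metis
  moreover have "des ?\<tau> = des (remove_nth i \<sigma>)" by (rule des_order_iso[OF order_iso_reduce])
  ultimately show "Suc (des ?\<tau>) = d" using des_remove_nth[OF i] m by (simp add: d_minimal_def)
next
  assume r: "is_perm \<sigma> \<and> des \<sigma> = d \<and> (\<forall>i<length \<sigma>. Suc (des (reduce (remove_nth i \<sigma>))) = d)"
  show "d_minimal d \<sigma>" unfolding d_minimal_def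
  proof (intro conjI allI impI)
    fix \<tau> assume t: "is_perm \<tau> \<and> involved_in \<tau> \<sigma> \<and> des \<tau> = d"
    then obtain ys where ys: "subseq ys \<sigma>" "order_iso \<tau> ys" by (auto simp: involved_in_def)
    show "\<tau> = \<sigma>"
    proof (cases "ys = \<sigma>")
      case True then show ?thesis using ys t r order_iso_perm_eq by blast
    next
      case False
      then obtain i where i: "i < length \<sigma>" "subseq ys (remove_nth i \<sigma>)"
        using subseq_remove_nth ys by blast
      have "des \<tau> = des ys" using ys des_order_iso by blast
      also have "\<dots> \<le> des (remove_nth i \<sigma>)" using i des_subseq by blast
      also have "\<dots> = des (reduce (remove_nth i \<sigma>))" using des_order_iso[OF order_iso_reduce] by simp
      finally show ?thesis using t r i by fastforce
    qed
  qed (use r in \<open>blast+\<close>)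
qed (unfold d_minimal_def, blast+)

end

theory Submission imports Defs begin

text \<open>
  A permutation of length \<open>d + 3\<close> with \<open>d\<close> descents has exactly two ascents, so it consists of three
  decreasing runs \<open>X\<close>, \<open>Y\<close>, \<open>Z\<close>. It is determined by the word over \<open>{X, Y, Z}\<close> whose \<open>v\<close>-th letter
  names the run that holds the value \<open>v\<close>.

  Deleting an entry lowers the number of descents if and only if it leaves the number of ascents
  alone, that is, if what remains of the three runs is still separated by two ascents. Two decreasing
  runs \<open>X\<close> and \<open>Y\<close> are separated by an ascent if and only if some entry of \<open>X\<close> is smaller than some entry
  of \<open>Y\<close>, that is, if the word contains \<open>XY\<close> as a scattered subword. Such a pair remains after every
  deletion if and only if the word contains both \<open>XXY\<close> and \<open>XYY\<close>
  (\<open>pair_survives_deletion_iff\<close>). Hence minimal permutations correspond to the words of length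
  \<open>d + 3\<close> that contain the four subwords \<open>XXY\<close>, \<open>XYY\<close>, \<open>YYZ\<close>, \<open>YZZ\<close>
  (\<open>d_minimal_runs_perm_iff\<close>, \<open>num_minimal_eq_count\<close>).

  These words are recognised by reading them from left to right and keeping track of what
  remains to be found. This gives a recurrence in the length of the word
  (\<open>count_containing_Suc\<close>) that, apart from letters that change nothing, passes to strictly easier
  requirements. It is therefore solved one list of requirements after the other, and a list
  that \<open>m\<close> letters leave unchanged contributes terms \<open>m ^ n\<close>, possibly times a polynomial in \<open>n\<close>. This is
  where the terms \<open>3 ^ n\<close>, a quadratic polynomial times \<open>2 ^ n\<close>, and a quartic polynomial come from.
\<close>

section \<open>Descents of concatenated decreasing words\<close>

lemma des_append:
  "des (xs @ ys) = des xs + des ys + of_bool (xs \<noteq> [] \<and> ys \<noteq> [] \<and> last xs > hd ys)"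
proof (induction xs rule: induct_list012)
  case (2 x)
  show ?case by (cases ys) auto
qed auto

lemma des_decreasing: "sorted_wrt (>) xs \<Longrightarrow> des xs = length xs - 1"
  by (induction xs rule: induct_list012) auto

lemma des_less_length: "xs \<noteq> [] \<Longrightarrow> des xs < length xs"
  by (induction xs rule: induct_list012) auto

lemma decreasing_last_hd:
  fixes xs :: "nat list"
  assumes "sorted_wrt (>) xs" "v \<in> set xs"
  shows "last xs \<le> v" "v \<le> hd xs"
proof -
  show "v \<le> hd xs" using assms by (cases xs) auto
  show "last xs \<le> v" using assms by (induction xs) (auto intro: less_imp_le)
qed

text \<open>Inside the three words every adjacent pair is a descent, so only the two junctions can be ascents.
  The value \<open>length - 3\<close> is reached when both are, and an empty word leaves too few junctions for that.
  A junction of two decreasing words compares the minimum of the first with the maximum of the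
  second; it is an ascent if and only if some entry of the first is below some entry of the second.
  In this form the criterion mentions only the sets of entries, so it survives deletions.\<close>

lemma des_three_decreasing:
  assumes dec: "sorted_wrt (>) xs" "sorted_wrt (>) ys" "sorted_wrt (>) zs"
    and disj: "set xs \<inter> set ys = {}" "set ys \<inter> set zs = {}"
  shows "des (xs @ ys @ zs) + 3 = length (xs @ ys @ zs) \<longleftrightarrow>
    (\<exists>x\<in>set xs. \<exists>y\<in>set ys. x < y) \<and> (\<exists>y\<in>set ys. \<exists>z\<in>set zs. y < z)"
proof (cases "xs = [] \<or> ys = [] \<or> zs = []")
  case True
  then show ?thesis using dec by (auto simp: des_append des_decreasing)
next
  case False
  have junction: "(\<exists>a\<in>set as. \<exists>b\<in>set bs. a < b) \<longleftrightarrow> \<not> hd bs < last as"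
    if "as \<noteq> []" "bs \<noteq> []" "sorted_wrt (>) as" "sorted_wrt (>) bs" "set as \<inter> set bs = {}"
    for as bs :: "nat list"
  proof -
    have mem: "last as \<in> set as" "hd bs \<in> set bs" using that by simp_all
    then have "last as \<noteq> hd bs" using that(5) by auto
    moreover have "last as < hd bs" if "a \<in> set as" "b \<in> set bs" "a < b" for a b
      using that decreasing_last_hd(1)[of as a] decreasing_last_hd(2)[of bs b]
        \<open>sorted_wrt (>) as\<close> \<open>sorted_wrt (>) bs\<close> by simp
    ultimately show ?thesis using mem by (meson linorder_neqE_nat not_less_iff_gr_or_eq)
  qed
  obtain i j k where "length xs = Suc i" "length ys = Suc j" "length zs = Suc k"
    using False by (cases xs; cases ys; cases zs) auto
  moreover have "des (xs @ ys @ zs) = length xs - 1 + (length ys - 1) + (length zs - 1)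
      + of_bool (hd ys < last xs) + of_bool (hd zs < last ys)"
    using False by (simp add: des_append dec des_decreasing)
  ultimately have "des (xs @ ys @ zs) + 3 = length (xs @ ys @ zs) \<longleftrightarrow>
      \<not> hd ys < last xs \<and> \<not> hd zs < last ys"
    by simp
  then show ?thesis using False dec disj by (simp add: junction)
qed

text \<open>Cutting a nonempty word at its non-descents leaves one decreasing run more than there are cuts.\<close>

lemma exists_decreasing_runs:
  assumes "des xs + k = length xs"
  shows "\<exists>rs. length rs = k \<and> concat rs = xs \<and> (\<forall>r\<in>set rs. r \<noteq> [] \<and> sorted_wrt (>) r)"
  using assms
proof (induction xs arbitrary: k rule: induct_list012)
  case 1
  then show ?case by simp
next
  case (2 x)
  then show ?case by (intro exI[of _ "[[x]]"]) auto
next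
  case (3 x y zs)
  show ?case
  proof (cases "x > y")
    case True
    with 3(3) have "des (y # zs) + k = length (y # zs)" by simp
    from 3(2)[OF this] obtain rs where
      rs: "length rs = k" "concat rs = y # zs" "\<forall>r\<in>set rs. r \<noteq> [] \<and> sorted_wrt (>) r" by blast
    then obtain r rs' where [simp]: "rs = (y # r) # rs'"
      by (cases rs; cases "hd rs") auto
    show ?thesis using rs True by (intro exI[of _ "(x # y # r) # rs'"]) auto
  next
    case False
    with 3(3) have "k > 0" "des (y # zs) + (k - 1) = length (y # zs)"
      using des_less_length[of "y # zs"] by simp_all
    from 3(2)[OF this(2)] obtain rs where
      "length rs = k - 1" "concat rs = y # zs" "\<forall>r\<in>set rs. r \<noteq> [] \<and> sorted_wrt (>) r" by blast
    then show ?thesis using \<open>k > 0\<close> by (intro exI[of _ "[x] # rs"]) auto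
  qed
qed

text \<open>The first decreasing run ends at the first ascent. The entry below the head of the rest expresses
  that there is an ascent after the run, so that neither run can be prolonged into the other.\<close>

lemma decreasing_run_unique:
  fixes xs xs' rest rest' :: "nat list"
  assumes "xs @ rest = xs' @ rest'" "sorted_wrt (>) xs" "sorted_wrt (>) xs'"
    and "rest \<noteq> []" "rest' \<noteq> []" "x \<in> set xs" "x < hd rest" "x' \<in> set xs'" "x' < hd rest'"
  shows "xs = xs'"
proof -
  have no_longer: "us = []"
    if "sorted_wrt (>) (as @ us)" "a \<in> set as" "a < hd (us @ bs)" for as us bs :: "nat list" and a
    using that by (cases us) (auto simp: sorted_wrt_append dest: less_trans)
  from assms(1) obtain us where "xs = xs' @ us \<and> us @ rest = rest' \<or> xs @ us = xs' \<and> rest = us @ rest'"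
    by (auto simp: append_eq_append_conv2)
  then show ?thesis
    using assms no_longer[of xs us x rest'] no_longer[of xs' us x' rest] by auto
qed

section \<open>Deleting one entry\<close>

text \<open>Entries of a permutation are distinct, so deleting a position is the same as filtering out a value;
  unlike positions, values are compatible with the division into runs. Renaming is harmless because
  it preserves descents.\<close>

lemma d_minimal_iff_filter:
  "d_minimal d \<sigma> \<longleftrightarrow> is_perm \<sigma> \<and> des \<sigma> = d \<and> (\<forall>v\<in>set \<sigma>. Suc (des (filter (\<lambda>u. u \<noteq> v) \<sigma>)) = d)"
proof -
  have "reduce (remove_nth i \<sigma>) = reduce (filter (\<lambda>u. u \<noteq> \<sigma> ! i) \<sigma>)"
    if "distinct \<sigma>" "i < length \<sigma>" for i
  proof -
    have "\<sigma> = take i \<sigma> @ \<sigma> ! i # drop (Suc i) \<sigma>" using that(2) by (rule id_take_nth_drop)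
    then have "distinct (take i \<sigma> @ \<sigma> ! i # drop (Suc i) \<sigma>)"
      and "filter (\<lambda>u. u \<noteq> \<sigma> ! i) \<sigma> = filter (\<lambda>u. u \<noteq> \<sigma> ! i) (take i \<sigma> @ \<sigma> ! i # drop (Suc i) \<sigma>)"
      using that(1) by metis+
    moreover from this(1) have "filter (\<lambda>u. u \<noteq> \<sigma> ! i) (take i \<sigma>) = take i \<sigma>"
      "filter (\<lambda>u. u \<noteq> \<sigma> ! i) (drop (Suc i) \<sigma>) = drop (Suc i) \<sigma>"
      by (auto simp: filter_id_conv)
    ultimately have "filter (\<lambda>u. u \<noteq> \<sigma> ! i) \<sigma> = remove_nth i \<sigma>"
      by (simp add: remove_nth_def)
    then show ?thesis by simp
  qed
  moreover have "des (reduce xs) = des xs" for xs by (rule des_order_iso[OF order_iso_reduce])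
  ultimately show ?thesis
    unfolding d_minimal_iff is_perm_iff all_set_conv_all_nth by metis
qed

text \<open>Deleting \<open>Min A\<close> forces a pair \<open>a < b\<close> whose lower end lies above \<open>Min A\<close>, and deleting \<open>Max B\<close>
  forces one whose upper end lies below \<open>Max B\<close>; these are the two triples. Conversely, deleting an
  element of \<open>A\<close> leaves a pair from the first triple, and deleting anything else leaves
  a pair from the second.\<close>

lemma pair_survives_deletion_iff:
  fixes A B V :: "'a :: linorder set"
  assumes "finite A" "finite B" "A \<inter> B = {}" "A \<union> B \<subseteq> V"
  shows "(\<exists>a\<in>A. \<exists>b\<in>B. a < b) \<and> (\<forall>v\<in>V. \<exists>a\<in>A - {v}. \<exists>b\<in>B - {v}. a < b) \<longleftrightarrow>
    (\<exists>a\<in>A. \<exists>a'\<in>A. \<exists>b\<in>B. a < a' \<and> a' < b) \<and> (\<exists>a\<in>A. \<exists>b\<in>B. \<exists>b'\<in>B. a < b \<and> b < b')"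
    (is "?survives \<longleftrightarrow> ?aab \<and> ?abb")
proof
  assume S: ?survives
  then have ne: "A \<noteq> {}" "B \<noteq> {}" by auto
  then have "Min A \<in> V" "Max B \<in> V" using assms Min_in[of A] Max_in[of B] by blast+
  then obtain a b a' b' where *: "a \<in> A - {Min A}" "b \<in> B" "a < b"
    "a' \<in> A" "b' \<in> B - {Max B}" "a' < b'"
    using S by blast
  have "Min A < a" "b' < Max B"
    using * assms by (auto simp: order.strict_iff_order)
  moreover have "Min A \<in> A" "Max B \<in> B" using ne assms(1,2) by simp_all
  ultimately have ?aab ?abb using * by blast+
  then show "?aab \<and> ?abb" ..
next
  assume P: "?aab \<and> ?abb"
  from conjunct1[OF P] obtain a a' b where
    aab: "a \<in> A" "a' \<in> A" "b \<in> B" "a < a'" "a' < b" by blast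
  from conjunct2[OF P] obtain c d d' where
    abb: "c \<in> A" "d \<in> B" "d' \<in> B" "c < d" "d < d'" by blast
  have less: "a < b" "c < d'" "a \<noteq> a'" "d \<noteq> d'" using aab abb by auto
  have "\<exists>a\<in>A - {v}. \<exists>b\<in>B - {v}. a < b" for v
  proof (cases "v \<in> A")
    case True
    then have "b \<in> B - {v}" using aab assms(3) by auto
    moreover have "a \<in> A - {v} \<or> a' \<in> A - {v}" using aab less by auto
    ultimately show ?thesis using aab(5) less(1) by blast
  next
    case False
    then have "c \<in> A - {v}" using abb by auto
    moreover have "d \<in> B - {v} \<or> d' \<in> B - {v}" using abb less by auto
    ultimately show ?thesis using abb(4) less(2) by blast
  qed
  then show ?survives using aab less(1) by blast
qed

section \<open>Permutations with three runs as words\<close>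

datatype run = X | Y | Z

lemma run_UNIV: "(UNIV :: run set) = {X, Y, Z}"
  using run.exhaust by blast

lemma finite_run: "finite (UNIV :: run set)"
  by (simp add: run_UNIV)

text \<open>The letter at index \<open>i\<close> of a word is the run that holds the value \<open>i + 1\<close>. The indices are listed in
  reverse because runs decrease.\<close>

definition entries :: "run \<Rightarrow> run list \<Rightarrow> nat list" where
  "entries a w = map Suc (filter (\<lambda>i. w ! i = a) (rev [0..<length w]))"

definition runs_perm :: "run list \<Rightarrow> nat list" where
  "runs_perm w = entries X w @ entries Y w @ entries Z w"

lemma set_entries: "set (entries a w) = Suc ` {i. i < length w \<and> w ! i = a}"
  by (auto simp: entries_def)

lemma entries_disjoint: "a \<noteq> b \<Longrightarrow> set (entries a w) \<inter> set (entries b w) = {}"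
  by (auto simp: set_entries)

lemma decreasing_entries: "sorted_wrt (>) (entries a w)"
  by (simp add: entries_def sorted_wrt_map sorted_wrt_filter sorted_wrt_rev)

lemma decreasing_distinct: "sorted_wrt (>) (xs :: nat list) \<Longrightarrow> distinct xs"
  by (induction xs) auto

lemma decreasing_unique:
  fixes xs ys :: "nat list"
  assumes "sorted_wrt (>) xs" "sorted_wrt (>) ys" "set xs = set ys"
  shows "xs = ys"
  using strict_sorted_equal[of "rev xs" "rev ys"] assms by (simp add: sorted_wrt_rev)

lemma set_runs_perm: "set (runs_perm w) = {1..length w}"
proof -
  have "v \<in> set (runs_perm w)" if "v \<in> {1..length w}" for v
    using that by (cases "w ! (v - 1)") (auto simp: runs_perm_def set_entries intro!: image_eqI[of _ _ "v - 1"])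
  moreover have "set (runs_perm w) \<subseteq> {1..length w}" by (auto simp: runs_perm_def set_entries)
  ultimately show ?thesis by blast
qed

lemma distinct_runs_perm: "distinct (runs_perm w)"
  using entries_disjoint[of _ _ w] decreasing_distinct[OF decreasing_entries]
  by (auto simp: runs_perm_def)

lemma length_runs_perm [simp]: "length (runs_perm w) = length w"
  using distinct_card[OF distinct_runs_perm] by (simp add: set_runs_perm)

lemma is_perm_runs_perm: "is_perm (runs_perm w)"
  by (simp add: is_perm_iff distinct_runs_perm set_runs_perm)

lemma subseq_Cons_iff_nth:
  "subseq (a # p) w \<longleftrightarrow> (\<exists>i<length w. w ! i = a \<and> subseq p (drop (Suc i) w))"
proof (induction w)
  case (Cons x w)
  have "subseq (a # p) w \<Longrightarrow> subseq p w" by (rule subseq_Cons')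
  then show ?case using Cons by (auto simp: less_Suc_eq_0_disj)
qed simp

text \<open>This translates a chain of values in prescribed runs into a scattered subword.\<close>

lemma subseq_three_iff:
  "subseq [a, b, c] w \<longleftrightarrow>
    (\<exists>i\<in>set (entries a w). \<exists>j\<in>set (entries b w). \<exists>k\<in>set (entries c w). i < j \<and> j < k)"
proof
  assume "subseq [a, b, c] w"
  then obtain i where i: "i < length w" "w ! i = a" "subseq [b, c] (drop (Suc i) w)"
    by (auto simp: subseq_Cons_iff_nth[of a])
  from i(3) obtain j where j: "j < length (drop (Suc i) w)" "drop (Suc i) w ! j = b"
      "subseq [c] (drop (Suc j) (drop (Suc i) w))"
    unfolding subseq_Cons_iff_nth[of b] by blast
  from j(3) obtain k where k: "k < length (drop (Suc j) (drop (Suc i) w))"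
      "drop (Suc j) (drop (Suc i) w) ! k = c"
    unfolding subseq_Cons_iff_nth[of c] by blast
  have "Suc i \<in> set (entries a w)" "Suc (Suc i + j) \<in> set (entries b w)"
      "Suc (Suc (Suc i + j) + k) \<in> set (entries c w)"
    using i j k by (auto simp: set_entries ac_simps)
  moreover have "Suc i < Suc (Suc i + j)" "Suc (Suc i + j) < Suc (Suc (Suc i + j) + k)" by simp_all
  ultimately show "\<exists>i\<in>set (entries a w). \<exists>j\<in>set (entries b w). \<exists>k\<in>set (entries c w). i < j \<and> j < k"
    by blast
next
  assume "\<exists>i\<in>set (entries a w). \<exists>j\<in>set (entries b w). \<exists>k\<in>set (entries c w). i < j \<and> j < k"
  then obtain i j k where *: "i < j" "j < k" "k < length w" "w ! i = a" "w ! j = b" "w ! k = c"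
    by (auto simp: set_entries)
  have "subseq [c] (drop (Suc j) w)"
    using * by (auto simp: subseq_Cons_iff_nth intro!: exI[of _ "k - Suc j"])
  then have "subseq [b, c] (drop (Suc i) w)"
    unfolding subseq_Cons_iff_nth[of b] using * by (auto intro!: exI[of _ "j - Suc i"])
  then show "subseq [a, b, c] w"
    unfolding subseq_Cons_iff_nth[of a] using * by (auto intro!: exI[of _ i])
qed

definition contains_all :: "run list list \<Rightarrow> run list \<Rightarrow> bool" where
  "contains_all P w \<longleftrightarrow> (\<forall>p\<in>set P. subseq p w)"

text \<open>Deleting an entry shortens the word by one, so it lowers the number of descents by one if and only
  if both ascents between the runs persist. Persistence under all deletions is what
  \<open>pair_survives_deletion_iff\<close> expresses, once for \<open>X\<close> against \<open>Y\<close> and once for \<open>Y\<close> against \<open>Z\<close>.\<close>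

lemma d_minimal_runs_perm_iff:
  assumes "length w = d + 3"
  shows "d_minimal d (runs_perm w) \<longleftrightarrow> contains_all [[X, X, Y], [X, Y, Y], [Y, Y, Z], [Y, Z, Z]] w"
proof -
  let ?A = "set (entries X w)" and ?B = "set (entries Y w)" and ?C = "set (entries Z w)"
  let ?V = "set (runs_perm w)"
  have disj: "?A \<inter> ?B = {}" "?B \<inter> ?C = {}" by (simp_all add: entries_disjoint)
  have V: "?A \<union> ?B \<subseteq> ?V" "?B \<union> ?C \<subseteq> ?V" by (auto simp: runs_perm_def)
  have whole: "des (runs_perm w) = d \<longleftrightarrow> (\<exists>a\<in>?A. \<exists>b\<in>?B. a < b) \<and> (\<exists>b\<in>?B. \<exists>c\<in>?C. b < c)"
    using des_three_decreasing[OF decreasing_entries decreasing_entries decreasing_entries disj]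
      length_runs_perm[of w] assms by (simp add: runs_perm_def)
  have deleted: "Suc (des (filter (\<lambda>u. u \<noteq> v) (runs_perm w))) = d \<longleftrightarrow>
      (\<exists>a\<in>?A - {v}. \<exists>b\<in>?B - {v}. a < b) \<and> (\<exists>b\<in>?B - {v}. \<exists>c\<in>?C - {v}. b < c)"
    if "v \<in> ?V" for v
  proof -
    let ?del = "filter (\<lambda>u. u \<noteq> v)"
    have "length (?del (runs_perm w)) = card (?V - {v})"
      using distinct_card[of "?del (runs_perm w)"] distinct_runs_perm[of w]
      by (simp add: set_diff_eq)
    also have "\<dots> = d + 2"
      using that assms by (simp add: set_runs_perm)
    finally have "Suc (des (?del (runs_perm w))) = d \<longleftrightarrow>
        des (?del (runs_perm w)) + 3 = length (?del (runs_perm w))" by auto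
    moreover have "?del (runs_perm w) = ?del (entries X w) @ ?del (entries Y w) @ ?del (entries Z w)"
      by (simp add: runs_perm_def)
    moreover have "set (?del (entries a w)) = set (entries a w) - {v}" for a by auto
    ultimately show ?thesis
      using des_three_decreasing[of "?del (entries X w)" "?del (entries Y w)" "?del (entries Z w)"] disj
      by (simp add: sorted_wrt_filter decreasing_entries) blast
  qed
  have "d_minimal d (runs_perm w) \<longleftrightarrow>
      ((\<exists>a\<in>?A. \<exists>b\<in>?B. a < b) \<and> (\<forall>v\<in>?V. \<exists>a\<in>?A - {v}. \<exists>b\<in>?B - {v}. a < b)) \<and>
      ((\<exists>b\<in>?B. \<exists>c\<in>?C. b < c) \<and> (\<forall>v\<in>?V. \<exists>b\<in>?B - {v}. \<exists>c\<in>?C - {v}. b < c))"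
    (is "_ \<longleftrightarrow> ?XY \<and> ?YZ")
    by (auto simp only: d_minimal_iff_filter is_perm_runs_perm whole ball_conj_distrib deleted
        cong: ball_cong)
  moreover have "?XY \<longleftrightarrow> contains_all [[X, X, Y], [X, Y, Y]] w"
    unfolding pair_survives_deletion_iff[OF finite_set finite_set disj(1) V(1)]
    by (simp add: contains_all_def subseq_three_iff)
  moreover have "?YZ \<longleftrightarrow> contains_all [[Y, Y, Z], [Y, Z, Z]] w"
    unfolding pair_survives_deletion_iff[OF finite_set finite_set disj(2) V(2)]
    by (simp add: contains_all_def subseq_three_iff)
  ultimately show ?thesis by (auto simp: contains_all_def)
qed

text \<open>For a minimal permutation both junctions are ascents, so the runs, and with them the word, can
  be read off from the permutation. Without the restriction to such words injectivity
  fails: a decreasing permutation comes from every word in which the letters of larger values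
  are never later in the alphabet.\<close>

lemma inj_on_runs_perm:
  "inj_on runs_perm {w. d_minimal d (runs_perm w) \<and> length w = d + 3}"
proof (rule inj_onI, goal_cases)
  case (1 w w')
  have ascents: "(\<exists>x\<in>set (entries X u). \<exists>y\<in>set (entries Y u). x < y) \<and>
      (\<exists>y\<in>set (entries Y u). \<exists>z\<in>set (entries Z u). y < z)"
    if "u \<in> {w. d_minimal d (runs_perm w) \<and> length w = d + 3}" for u
    using that des_three_decreasing[of "entries X u" "entries Y u" "entries Z u"] length_runs_perm[of u]
    by (simp add: d_minimal_def runs_perm_def decreasing_entries entries_disjoint)
  have before: "\<exists>x\<in>set (entries a u). x < hd (entries b u @ rest)"
    if "\<exists>x\<in>set (entries a u). \<exists>y\<in>set (entries b u). x < y" for a b u rest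
  proof -
    from that obtain x y where "x \<in> set (entries a u)" "y \<in> set (entries b u)" "x < y" by blast
    moreover from this(2) have "entries b u \<noteq> []" by auto
    ultimately show ?thesis using decreasing_last_hd(2)[OF decreasing_entries, of y b u]
      by (metis hd_append2 less_le_trans)
  qed
  note w = ascents[OF 1(1)] and w' = ascents[OF 1(2)]
  have eq: "entries X w @ entries Y w @ entries Z w = entries X w' @ entries Y w' @ entries Z w'"
    using 1(3) by (simp add: runs_perm_def)
  have X: "entries X w = entries X w'"
    using decreasing_run_unique[OF eq decreasing_entries decreasing_entries]
      before[of X w Y "entries Z w"] before[of X w' Y "entries Z w'"] w w' by fastforce
  with eq have eq: "entries Y w @ entries Z w = entries Y w' @ entries Z w'" by simp
  have Y: "entries Y w = entries Y w'"
    using decreasing_run_unique[OF eq decreasing_entries decreasing_entries]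
      before[of Y w Z "[]"] before[of Y w' Z "[]"] w w' by fastforce
  with eq have Z: "entries Z w = entries Z w'" by simp
  have len: "length w = length w'" using 1 by simp
  have "entries a w = entries a w'" for a using X Y Z by (cases a) auto
  then have sets: "{i. i < length w \<and> w ! i = a} = {i. i < length w' \<and> w' ! i = a}" for a
    using set_entries inj_image_eq_iff[OF inj_Suc] by metis
  show ?case
  proof (rule nth_equalityI[OF len])
    fix i assume "i < length w"
    then have "i \<in> {j. j < length w' \<and> w' ! j = w ! i}" using sets[of "w ! i"] by blast
    then show "w ! i = w' ! i" by simp
  qed
qed

lemma d_minimal_in_range:
  assumes "d_minimal d \<sigma>" "length \<sigma> = d + 3"
  shows "\<exists>w. length w = d + 3 \<and> runs_perm w = \<sigma>"
proof -
  have perm: "distinct \<sigma>" "set \<sigma> = {1..d + 3}" and "des \<sigma> + 3 = length \<sigma>"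
    using assms by (auto simp: d_minimal_def is_perm_iff)
  then obtain rs where "length rs = 3" "concat rs = \<sigma>" "\<forall>r\<in>set rs. r \<noteq> [] \<and> sorted_wrt (>) r"
    using exists_decreasing_runs by blast
  then obtain xs ys zs where \<sigma>: "\<sigma> = xs @ ys @ zs"
    and dec: "sorted_wrt (>) xs" "sorted_wrt (>) ys" "sorted_wrt (>) zs"
    by (auto simp: numeral_3_eq_3 length_Suc_conv)
  define w where "w = map (\<lambda>i. if Suc i \<in> set xs then X else if Suc i \<in> set ys then Y else Z) [0..<d + 3]"
  have idx: "v \<in> set \<sigma> \<longleftrightarrow> (\<exists>i<d + 3. v = Suc i)" for v
    unfolding perm by (auto simp: Suc_le_eq intro!: exI[of _ "v - 1"])
  have set_e: "set (entries a w) = {v \<in> set \<sigma>. (if v \<in> set xs then X else if v \<in> set ys then Y else Z) = a}" for a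
    by (auto simp: set_entries w_def idx)
  have "entries X w = xs"
    by (rule decreasing_unique[OF decreasing_entries dec(1)]) (use set_e[of X] \<sigma> perm(1) in auto)
  moreover have "entries Y w = ys"
    by (rule decreasing_unique[OF decreasing_entries dec(2)]) (use set_e[of Y] \<sigma> perm(1) in auto)
  moreover have "entries Z w = zs"
    by (rule decreasing_unique[OF decreasing_entries dec(3)]) (use set_e[of Z] \<sigma> perm(1) in auto)
  ultimately have "runs_perm w = \<sigma>" by (simp add: runs_perm_def \<sigma>)
  then show ?thesis by (intro exI[of _ w]) (simp add: w_def)
qed

section \<open>Counting words that contain given subwords\<close>

definition count_containing :: "nat \<Rightarrow> run list list \<Rightarrow> nat" where
  "count_containing n P = card {w. length w = n \<and> contains_all P w}"

lemma num_minimal_eq_count: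
  "num_minimal (d + 3) d = count_containing (d + 3) [[X, X, Y], [X, Y, Y], [Y, Y, Z], [Y, Z, Z]]"
proof -
  let ?W = "{w. d_minimal d (runs_perm w) \<and> length w = d + 3}"
  have "{\<sigma>. d_minimal d \<sigma> \<and> length \<sigma> = d + 3} = runs_perm ` ?W"
    using d_minimal_in_range by auto
  then have "num_minimal (d + 3) d = card ?W"
    by (simp add: num_minimal_def card_image[OF inj_on_runs_perm])
  also have "?W = {w. length w = d + 3 \<and> contains_all [[X, X, Y], [X, Y, Y], [Y, Y, Z], [Y, Z, Z]] w}"
    using d_minimal_runs_perm_iff by blast
  finally show ?thesis by (simp only: count_containing_def)
qed

text \<open>After a letter \<open>a\<close> has been read, \<open>strip a p\<close> is what remains to be found of the subword \<open>p\<close>.\<close>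

fun strip :: "'a \<Rightarrow> 'a list \<Rightarrow> 'a list" where
  "strip a [] = []"
| "strip a (x # p) = (if x = a then p else x # p)"

lemma subseq_strip: "subseq p (a # w) \<longleftrightarrow> subseq (strip a p) w"
  by (cases p) auto

text \<open>A requirement that is a subword of another one is redundant. Dropping it keeps the set of lists that
  the recurrence reaches small: from the four patterns above it reaches \<open>31\<close> lists.\<close>

fun prune :: "'a list list \<Rightarrow> 'a list list" where
  "prune [] = []"
| "prune (p # P) = (if p = [] \<or> (\<exists>q\<in>set P. subseq p q) then prune P
     else p # filter (\<lambda>q. \<not> subseq q p) (prune P))"

lemma contains_all_prune: "contains_all (prune P) w \<longleftrightarrow> contains_all P w"
proof (induction P)
  case (Cons p P)
  then show ?case
    by (auto simp: contains_all_def intro: subseq_order.order_trans)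
qed simp

lemma count_containing_0 [simp]: "count_containing 0 P = of_bool (\<forall>p\<in>set P. p = [])"
proof -
  have "{w. length w = 0 \<and> contains_all P w} = (if \<forall>p\<in>set P. p = [] then {[]} else {})"
    by (auto simp: contains_all_def) (metis list_emb_Nil2)
  then show ?thesis by (simp add: count_containing_def)
qed

lemma count_containing_Suc:
  "count_containing (Suc n) P = count_containing n (prune (map (strip X) P))
     + count_containing n (prune (map (strip Y) P)) + count_containing n (prune (map (strip Z) P))"
proof -
  let ?S = "\<lambda>a. {w. length w = n \<and> contains_all (map (strip a) P) w}"
  have split: "{w. length w = Suc n \<and> contains_all P w} = (\<Union>a. (#) a ` ?S a)"
    by (auto simp: length_Suc_conv contains_all_def subseq_strip image_iff)
  have fin: "finite (?S a)" for a
    using finite_lists_length_eq[OF finite_run, of n] by (rule rev_finite_subset) auto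
  have "card (\<Union>a. (#) a ` ?S a) = (\<Sum>a\<in>UNIV. card ((#) a ` ?S a))"
    by (rule card_UN_disjoint) (auto simp: run_UNIV fin)
  then show ?thesis
    by (simp add: count_containing_def contains_all_prune split run_UNIV card_image)
qed

section \<open>Solving the recurrence\<close>

text \<open>The lists of requirements appear in an order in which the recurrence for each list refers only to
  that list and earlier ones, and each formula is verified by induction on \<open>n\<close>. Where every letter
  changes the list, as for \<open>[[X, Y], [Y, Y], [Z]]\<close>, the recurrence determines the numbers for positive
  lengths without using the one for length \<open>0\<close>, which need not fit the formula; such exceptions
  propagate to a few small lengths of later lists. This is the reason for the lower bounds on \<open>n\<close>.\<close>

lemma count_all [simp]:
  "real (count_containing n []) =
    3 ^ n"
  by (induction n) (simp_all add: count_containing_Suc numeral_eq_Suc field_simps)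

lemma count_Z [simp]:
  "real (count_containing n [[Z]]) =
    3 ^ n - 2 ^ n"
  by (induction n) (simp_all add: count_containing_Suc numeral_eq_Suc field_simps)

lemma count_ZZ [simp]:
  "real (count_containing n [[Z, Z]]) =
    3 ^ n - (real n + 2) / 2 * 2 ^ n"
  by (induction n) (simp_all add: count_containing_Suc numeral_eq_Suc field_simps)

lemma count_YZ [simp]:
  "real (count_containing n [[Y, Z]]) =
    3 ^ n - (real n + 2) / 2 * 2 ^ n"
  by (induction n) (simp_all add: count_containing_Suc numeral_eq_Suc field_simps)

lemma count_YZ_ZZ [simp]:
  "real (count_containing n [[Y, Z], [Z, Z]]) =
    3 ^ n - real n * 2 ^ n - 1"
  by (induction n) (simp_all add: count_containing_Suc numeral_eq_Suc field_simps)

lemma count_YYZ_YZZ [simp]: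
  "real (count_containing n [[Y, Y, Z], [Y, Z, Z]]) =
    3 ^ n - (real n ^ 2 - real n + 8) / 4 * 2 ^ n + 1"
  by (induction n) (simp_all add: count_containing_Suc numeral_eq_Suc field_simps)

lemma count_Y [simp]:
  "real (count_containing n [[Y]]) =
    3 ^ n - 2 ^ n"
  by (induction n) (simp_all add: count_containing_Suc numeral_eq_Suc field_simps)

lemma count_Y_Z [simp]:
  "real (count_containing n [[Y], [Z]]) =
    3 ^ n - 2 * 2 ^ n + 1"
  by (induction n) (simp_all add: count_containing_Suc numeral_eq_Suc field_simps)

lemma count_Y_ZZ [simp]:
  "real (count_containing n [[Y], [Z, Z]]) =
    3 ^ n - (real n + 4) / 2 * 2 ^ n + real n + 1"
  by (induction n) (simp_all add: count_containing_Suc numeral_eq_Suc field_simps)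

lemma count_XY [simp]:
  "real (count_containing n [[X, Y]]) =
    3 ^ n - (real n + 2) / 2 * 2 ^ n"
  by (induction n) (simp_all add: count_containing_Suc numeral_eq_Suc field_simps)

lemma count_XY_Z [simp]:
  "real (count_containing n [[X, Y], [Z]]) =
    3 ^ n - (real n + 4) / 2 * 2 ^ n + real n + 1"
  by (induction n) (simp_all add: count_containing_Suc numeral_eq_Suc field_simps)

lemma count_XY_ZZ [simp]:
  "real (count_containing n [[X, Y], [Z, Z]]) =
    3 ^ n - (real n + 2) * 2 ^ n + real n ^ 2 + real n + 1"
  by (induction n) (simp_all add: count_containing_Suc numeral_eq_Suc field_simps)

lemma count_XY_YZ [simp]:
  "real (count_containing n [[X, Y], [Y, Z]]) =
    3 ^ n - (real n + 1) * 2 ^ n + (real n ^ 2 + real n) / 2"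
  by (induction n) (simp_all add: count_containing_Suc numeral_eq_Suc field_simps)

lemma count_XY_YZ_ZZ [simp]:
  "n \<ge> 1 \<Longrightarrow> real (count_containing n [[X, Y], [Y, Z], [Z, Z]]) =
    3 ^ n - 3 * real n / 2 * 2 ^ n + (3 * real n ^ 2 - 3 * real n) / 2"
  by (induction n rule: nat_induct_at_least)
     (simp_all add: count_containing_Suc numeral_eq_Suc field_simps)

lemma count_XY_YYZ_YZZ [simp]:
  "n \<ge> 1 \<Longrightarrow> real (count_containing n [[X, Y], [Y, Y, Z], [Y, Z, Z]]) =
    3 ^ n - (real n ^ 2 + real n + 4) / 4 * 2 ^ n
    + (real n ^ 3 - 3 * real n ^ 2 + 4 * real n - 2) / 2"
  by (induction n rule: nat_induct_at_least)
     (simp_all add: count_containing_Suc numeral_eq_Suc field_simps)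

lemma count_YY_YZ [simp]:
  "real (count_containing n [[Y, Y], [Y, Z]]) =
    3 ^ n - real n * 2 ^ n - 1"
  by (induction n) (simp_all add: count_containing_Suc numeral_eq_Suc field_simps)

lemma count_YY_YZ_ZZ [simp]:
  "real (count_containing n [[Y, Y], [Y, Z], [Z, Z]]) =
    3 ^ n - (3 * real n - 2) / 2 * 2 ^ n + (real n ^ 2 - real n - 4) / 2"
  by (induction n) (simp_all add: count_containing_Suc numeral_eq_Suc field_simps)

lemma count_XY_YY_YZ [simp]:
  "real (count_containing n [[X, Y], [Y, Y], [Y, Z]]) =
    3 ^ n - (3 * real n - 2) / 2 * 2 ^ n + (real n ^ 2 - real n - 4) / 2"
  by (induction n) (simp_all add: count_containing_Suc numeral_eq_Suc field_simps)

lemma count_XY_YY_YZ_ZZ [simp]: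
  "n \<ge> 1 \<Longrightarrow> real (count_containing n [[X, Y], [Y, Y], [Y, Z], [Z, Z]]) =
    3 ^ n - (2 * real n - 2) * 2 ^ n + 2 * real n ^ 2 - 4 * real n - 1"
  by (induction n rule: nat_induct_at_least)
     (simp_all add: count_containing_Suc numeral_eq_Suc field_simps)

lemma count_YY [simp]:
  "real (count_containing n [[Y, Y]]) =
    3 ^ n - (real n + 2) / 2 * 2 ^ n"
  by (induction n) (simp_all add: count_containing_Suc numeral_eq_Suc field_simps)

lemma count_YY_Z [simp]:
  "real (count_containing n [[Y, Y], [Z]]) =
    3 ^ n - (real n + 4) / 2 * 2 ^ n + real n + 1"
  by (induction n) (simp_all add: count_containing_Suc numeral_eq_Suc field_simps)

lemma count_YY_ZZ [simp]:
  "real (count_containing n [[Y, Y], [Z, Z]]) =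
    3 ^ n - (real n + 2) * 2 ^ n + real n ^ 2 + real n + 1"
  by (induction n) (simp_all add: count_containing_Suc numeral_eq_Suc field_simps)

lemma count_XY_YY [simp]:
  "real (count_containing n [[X, Y], [Y, Y]]) =
    3 ^ n - real n * 2 ^ n - 1"
  by (induction n) (simp_all add: count_containing_Suc numeral_eq_Suc field_simps)

lemma count_XY_YY_Z [simp]:
  "n \<ge> 1 \<Longrightarrow> real (count_containing n [[X, Y], [Y, Y], [Z]]) =
    3 ^ n - (real n + 1) * 2 ^ n + 2 * real n - 1"
  by (induction n rule: nat_induct_at_least)
     (simp_all add: count_containing_Suc numeral_eq_Suc field_simps)

lemma count_XY_YY_ZZ [simp]:
  "n \<ge> 2 \<Longrightarrow> real (count_containing n [[X, Y], [Y, Y], [Z, Z]]) =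
    3 ^ n - (3 * real n + 2) / 2 * 2 ^ n + 2 * real n ^ 2 - 1"
  by (induction n rule: nat_induct_at_least)
     (simp_all add: count_containing_Suc numeral_eq_Suc field_simps)

lemma count_XXY_XYY [simp]:
  "real (count_containing n [[X, X, Y], [X, Y, Y]]) =
    3 ^ n - (real n ^ 2 - real n + 8) / 4 * 2 ^ n + 1"
  by (induction n) (simp_all add: count_containing_Suc numeral_eq_Suc field_simps)

lemma count_XXY_XYY_Z [simp]:
  "n \<ge> 1 \<Longrightarrow> real (count_containing n [[X, X, Y], [X, Y, Y], [Z]]) =
    3 ^ n - (real n ^ 2 - real n + 12) / 4 * 2 ^ n + real n ^ 2 - real n + 3"
  by (induction n rule: nat_induct_at_least)
     (simp_all add: count_containing_Suc numeral_eq_Suc field_simps)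

lemma count_XXY_XYY_ZZ [simp]:
  "n \<ge> 2 \<Longrightarrow> real (count_containing n [[X, X, Y], [X, Y, Y], [Z, Z]]) =
    3 ^ n - (real n ^ 2 + real n + 12) / 4 * 2 ^ n
    + real n ^ 3 - 2 * real n ^ 2 + 3 * real n + 3"
  by (induction n rule: nat_induct_at_least)
     (simp_all add: count_containing_Suc numeral_eq_Suc field_simps)

lemma count_XXY_XYY_YZ [simp]:
  "n \<ge> 1 \<Longrightarrow> real (count_containing n [[X, X, Y], [X, Y, Y], [Y, Z]]) =
    3 ^ n - (real n ^ 2 + real n + 4) / 4 * 2 ^ n
    + (real n ^ 3 - 3 * real n ^ 2 + 4 * real n - 2) / 2"
  by (induction n rule: nat_induct_at_least)
     (simp_all add: count_containing_Suc numeral_eq_Suc field_simps)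

lemma count_XXY_XYY_YZ_ZZ [simp]:
  "n \<ge> 3 \<Longrightarrow> real (count_containing n [[X, X, Y], [X, Y, Y], [Y, Z], [Z, Z]]) =
    3 ^ n - (real n ^ 2 + 3 * real n) / 4 * 2 ^ n
    + (3 * real n ^ 3 - 12 * real n ^ 2 + 17 * real n - 6) / 2"
  by (induction n rule: nat_induct_at_least)
     (simp_all add: count_containing_Suc numeral_eq_Suc field_simps)

lemma count_XXY_XYY_YYZ_YZZ [simp]:
  "n \<ge> 3 \<Longrightarrow> real (count_containing n [[X, X, Y], [X, Y, Y], [Y, Y, Z], [Y, Z, Z]]) =
    3 ^ n - (real n ^ 2 - 2 * real n + 4) / 2 * 2 ^ n
    + (real n ^ 4 - 7 * real n ^ 3 + 19 * real n ^ 2 - 21 * real n + 2) / 2"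
  by (induction n rule: nat_induct_at_least)
     (simp_all add: count_containing_Suc numeral_eq_Suc field_simps)

theorem theorem4p4:
  fixes d :: nat
  assumes "d \<ge> 3"
  shows "real (num_minimal (d + 3) d) =
    3 ^ (d + 3) - (real d ^ 2 + 4 * real d + 7) * 2 ^ (d + 2)
    + 1 / 2 * real d ^ 4 + 5 / 2 * real d ^ 3 + 5 * real d ^ 2 + 6 * real d + 1"
  using count_XXY_XYY_YYZ_YZZ[of "d + 3", folded num_minimal_eq_count]
  by (simp add: numeral_eq_Suc field_simps)

end
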